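(* Let $A\subseteq\mathbb Z^d$ be a finite set containing $0$ such that the subgroup $\langle A\rangle$ generated by $A$ has rank $d$. If $A$ is individually $C$-incompressible, then $C>d$.
   Context: A finite set $A\subseteq\mathbb Z^d$ with $0\in A$ is individually $C$-incompressible if for every sequence of translates $\{A+u_i\}_{i=1}^I$ with $u_i\notin\bigcup_{j<i}(A+u_j)$ for all $i$, the number of sets $A+u_i$ containing $0$ is at most $C$. *)

theory Defs
  imports "HOL-Analysis.Analysis"
begin

text \<open>Points of Z^d are modelled as vectors of type int^'n, with d = CARD('n).\<close>

text \<open>The translate A + u.\<close>
definition translate :: "(int ^ 'n) set \<Rightarrow> int ^ 'n \<Rightarrow> (int ^ 'n) set" where
  "translate A u = (\<lambda>a. a + u) ` A"

text \<open>Individual C-incompressibility: for every finite sequence of translates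
  A + u_0, ..., A + u_(I-1) with u_i not in the union of the earlier translates,
  the number of translates containing 0 is at most C.\<close>
definition indiv_incompressible :: "(int ^ 'n) set \<Rightarrow> real \<Rightarrow> bool" where
  "indiv_incompressible A C \<longleftrightarrow>
     (\<forall>(I::nat) (u::nat \<Rightarrow> int ^ 'n).
        (\<forall>i<I. u i \<notin> (\<Union>j<i. translate A (u j))) \<longrightarrow>
        real (card {i. i < I \<and> (0::int^'n) \<in> translate A (u i)}) \<le> C)"

text \<open>The subgroup of Z^d generated by A (integer linear combinations).\<close>
definition gen_subgroup :: "(int ^ 'n) set \<Rightarrow> (int ^ 'n) set" where
  "gen_subgroup A = {(\<Sum>a\<in>F. c a *s a) | F c. finite F \<and> F \<subseteq> A}"

text \<open>Z-linear independence of a finite set of vectors.\<close>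
definition int_independent :: "(int ^ 'n) set \<Rightarrow> bool" where
  "int_independent S \<longleftrightarrow> finite S \<and>
     (\<forall>c. (\<Sum>a\<in>S. c a *s a) = 0 \<longrightarrow> (\<forall>a\<in>S. c a = (0::int)))"

text \<open>Rank of a subgroup H of Z^d: maximal size of a Z-independent subset.\<close>
definition group_rank :: "(int ^ 'n) set \<Rightarrow> nat" where
  "group_rank H = Max {card S | S. S \<subseteq> H \<and> int_independent S}"

end

theory Submission
  imports Defs
begin

text \<open>Since \<open>\<langle>A\<rangle>\<close> has rank \<open>d\<close>, the set \<open>A\<close> spans \<open>\<rat>\<^sup>d\<close>. Greedily pick
  \<open>a\<^sub>0, \<dots>, a\<^sub>d \<in> A\<close> with \<open>a\<^sub>l - a\<^sub>j \<notin> A\<close> for \<open>j < l\<close>: the next point maximises over \<open>A\<close>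
  a linear functional that is \<open>-1\<close> at the points already chosen, and while these are
  fewer than \<open>d\<close> the functional is tilted so that the maximiser leaves their span, which
  keeps them linearly independent. Then \<open>A - a\<^sub>d, \<dots>, A - a\<^sub>0\<close> is an admissible
  sequence of \<open>d + 1\<close> translates, all containing \<open>0\<close>.\<close>

section \<open>Integer vectors as rational vectors\<close>

definition rat_vec :: "int ^ 'n \<Rightarrow> rat ^ 'n" where
  "rat_vec v = (\<chi> i. of_int (v $ i))"

lemma rat_vec_0 [simp]: "rat_vec 0 = 0"
  by (simp add: rat_vec_def vec_eq_iff)

lemma rat_vec_add: "rat_vec (x + y) = rat_vec x + rat_vec y"
  by (simp add: rat_vec_def vec_eq_iff)

lemma rat_vec_diff: "rat_vec (x - y) = rat_vec x - rat_vec y"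
  by (simp add: rat_vec_def vec_eq_iff)

lemma rat_vec_scale: "rat_vec (c *s x) = of_int c *s rat_vec x"
  by (simp add: rat_vec_def vec_eq_iff)

lemma rat_vec_sum: "rat_vec (\<Sum>a\<in>F. f a) = (\<Sum>a\<in>F. rat_vec (f a))"
  by (induction F rule: infinite_finite_induct) (auto simp: rat_vec_add)

lemma inj_rat_vec: "inj rat_vec"
  by (rule injI) (simp add: rat_vec_def vec_eq_iff)

lemma rat_vec_eq_0_iff [simp]: "rat_vec x = 0 \<longleftrightarrow> x = 0"
  using inj_rat_vec rat_vec_0 by (metis injD)

lemma card_rat_vec_image [simp]: "card (rat_vec ` S) = card S"
  using card_image inj_on_subset[OF inj_rat_vec] by (metis subset_UNIV)

lemma rat_common_denominator:
  fixes q :: "'a \<Rightarrow> rat"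
  assumes "finite S"
  shows "\<exists>d::int. d > 0 \<and> (\<forall>s\<in>S. of_int d * q s \<in> \<int>)"
  using assms
proof (induction rule: finite_induct)
  case empty
  show ?case by (intro exI[of _ 1]) auto
next
  case (insert x F)
  then obtain d where d: "d > 0" "\<forall>s\<in>F. of_int d * q s \<in> \<int>"
    by auto
  obtain n m where nm: "quotient_of (q x) = (n, m)"
    by (cases "quotient_of (q x)") auto
  have "m > 0"
    using quotient_of_denom_pos[OF nm] .
  have "of_int (d * m) * q x = of_int (d * n)"
    using \<open>m > 0\<close> by (simp add: quotient_of_div[OF nm])
  moreover have "of_int (d * m) * q s \<in> \<int>" if "s \<in> F" for s
  proof -
    have "of_int (d * m) * q s = of_int m * (of_int d * q s)"
      by simp
    then show ?thesis
      using d(2) that by (metis Ints_mult Ints_of_int)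
  qed
  ultimately show ?case
    using d(1) \<open>m > 0\<close> by (intro exI[of _ "d * m"]) (auto simp del: of_int_mult)
qed

lemma int_independent_imp_independent_rat_vec:
  assumes "int_independent S"
  shows "vec.independent (rat_vec ` S)"
proof
  have "finite S"
    using assms unfolding int_independent_def by auto
  assume "vec.dependent (rat_vec ` S)"
  then obtain u where u: "\<exists>v\<in>rat_vec ` S. u v \<noteq> 0" "(\<Sum>v\<in>rat_vec ` S. u v *s v) = 0"
    using vec.dependent_finite[of "rat_vec ` S"] \<open>finite S\<close> by auto
  have u0: "(\<Sum>s\<in>S. u (rat_vec s) *s rat_vec s) = 0"
    using u(2) by (simp add: sum.reindex[OF inj_on_subset[OF inj_rat_vec subset_UNIV]])
  obtain d where d: "d > 0" "\<forall>s\<in>S. of_int d * u (rat_vec s) \<in> \<int>"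
    using rat_common_denominator[OF \<open>finite S\<close>, of "u \<circ> rat_vec"] by auto
  define c where "c s = \<lfloor>of_int d * u (rat_vec s)\<rfloor>" for s
  have c: "of_int (c s) = of_int d * u (rat_vec s)" if "s \<in> S" for s
    using d(2) that unfolding c_def by (metis Ints_cases floor_of_int)
  have "rat_vec (\<Sum>s\<in>S. c s *s s) = (\<Sum>s\<in>S. of_int (c s) *s rat_vec s)"
    by (simp add: rat_vec_sum rat_vec_scale)
  also have "\<dots> = (\<Sum>s\<in>S. of_int d *s (u (rat_vec s) *s rat_vec s))"
    by (rule sum.cong) (auto simp: c vector_smult_assoc)
  also have "\<dots> = of_int d *s (\<Sum>s\<in>S. u (rat_vec s) *s rat_vec s)"
    by (simp add: vec.scale_sum_right)
  also have "\<dots> = 0"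
    using u0 by simp
  finally have "(\<Sum>s\<in>S. c s *s s) = 0"
    by simp
  then have "\<forall>s\<in>S. c s = 0"
    using assms unfolding int_independent_def by auto
  then show False
    using u(1) c d(1) by fastforce
qed

lemma card_le_CARD_if_int_independent:
  fixes S :: "(int ^ 'n) set"
  assumes "int_independent S"
  shows "card S \<le> CARD('n)"
  using vec.independent_card_le_dim[OF subset_UNIV int_independent_imp_independent_rat_vec[OF assms]]
  by (simp add: card_cart_basis)

lemma group_rank_attained:
  fixes H :: "(int ^ 'n) set"
  shows "\<exists>S\<subseteq>H. int_independent S \<and> card S = group_rank H"
proof -
  define X where "X = {card S | S. S \<subseteq> H \<and> int_independent S}"
  have "finite X"
    by (rule finite_subset[of _ "{..CARD('n)}"])
      (auto simp: X_def card_le_CARD_if_int_independent)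
  moreover have "int_independent {}"
    unfolding int_independent_def by simp
  then have "X \<noteq> {}"
    unfolding X_def by blast
  ultimately have "Max X \<in> X"
    by (rule Max_in)
  then show ?thesis
    unfolding group_rank_def X_def[symmetric] by (auto simp: X_def)
qed

lemma rat_vec_gen_subgroup_subset_span:
  "rat_vec ` gen_subgroup A \<subseteq> vec.span (rat_vec ` A)"
proof
  fix x
  assume "x \<in> rat_vec ` gen_subgroup A"
  then obtain F c where F: "finite F" "F \<subseteq> A" "x = rat_vec (\<Sum>a\<in>F. c a *s a)"
    unfolding gen_subgroup_def by auto
  then have "x = (\<Sum>a\<in>F. of_int (c a) *s rat_vec a)"
    by (simp add: rat_vec_sum rat_vec_scale)
  also have "\<dots> \<in> vec.span (rat_vec ` A)"
    using F(2) by (intro vec.span_sum vec.span_scale vec.span_base) auto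
  finally show "x \<in> vec.span (rat_vec ` A)" .
qed

lemma span_rat_vec_eq_UNIV_if_full_rank:
  fixes A :: "(int ^ 'n) set"
  assumes "group_rank (gen_subgroup A) = CARD('n)"
  shows "vec.span (rat_vec ` A) = UNIV"
proof -
  obtain S where S: "S \<subseteq> gen_subgroup A" "int_independent S" "card S = CARD('n)"
    using group_rank_attained assms by metis
  have "UNIV \<subseteq> vec.span (rat_vec ` S)"
    using vec.card_ge_dim_independent[of "rat_vec ` S" UNIV] int_independent_imp_independent_rat_vec[OF S(2)] S(3)
    by (simp add: card_cart_basis)
  also have "\<dots> \<subseteq> vec.span (rat_vec ` A)"
    using S(1) rat_vec_gen_subgroup_subset_span
    by (intro vec.span_minimal vec.subspace_span) blast
  finally show ?thesis
    by blast
qed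

section \<open>Linear functionals on \<open>'a ^ 'n\<close>\<close>

lemma vector_space_pair_vec_field:
  "vector_space_pair ((*s) :: 'a::field \<Rightarrow> 'a ^ 'n \<Rightarrow> 'a ^ 'n) (*)"
  ..

lemmas linear_functional_extend =
  vector_space_pair.linear_independent_extend[OF vector_space_pair_vec_field]

lemmas linear_functional_eq_on_span =
  vector_space_pair.linear_eq_on_span[OF vector_space_pair_vec_field]

lemmas linear_functional_diff =
  vector_space_pair.linear_diff[OF vector_space_pair_vec_field]

lemma linear_functional_separating_span:
  fixes B T :: "('a::linordered_field ^ 'n) set"
  assumes "finite T" "vec.independent B" "a \<notin> vec.span B"
  shows "\<exists>f. Vector_Spaces.linear (*s) (*) f \<and> (\<forall>x\<in>B. f x = -1) \<and>
    (\<forall>y\<in>T \<inter> vec.span B. f y < f a)"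
proof -
  obtain h where h: "Vector_Spaces.linear (*s) (*) h" "\<forall>x\<in>B. h x = -1"
    using linear_functional_extend[OF assms(2), of "\<lambda>_. -1"] by auto
  define M where "M = 1 + (\<Sum>y\<in>T. \<bar>h y\<bar>)"
  have "a \<notin> B"
    using assms(3) vec.span_base by blast
  have "vec.independent (insert a B)"
    using assms(2,3) by (simp add: vec.independent_insert)
  then obtain f where f: "Vector_Spaces.linear (*s) (*) f"
      "\<forall>x\<in>insert a B. f x = (if x = a then M else -1)"
    using linear_functional_extend[of "insert a B" "\<lambda>x. if x = a then M else -1"] by blast
  have f_B: "\<forall>x\<in>B. f x = -1"
    using f(2) \<open>a \<notin> B\<close> by auto
  have "f y < f a" if "y \<in> T" "y \<in> vec.span B" for y
  proof -
    have "f y = h y"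
      using linear_functional_eq_on_span[OF f(1) h(1) _ that(2)] f_B h(2) by simp
    also have "\<dots> \<le> (\<Sum>y\<in>T. \<bar>h y\<bar>)"
      using member_le_sum[of y T "\<lambda>y. \<bar>h y\<bar>"] assms(1) that(1) by simp
    also have "\<dots> < f a"
      using f(2) by (simp add: M_def)
    finally show ?thesis .
  qed
  then show ?thesis
    using f(1) f_B by blast
qed

section \<open>Difference-free chains\<close>

definition diff_free_chain :: "'a::ab_group_add set \<Rightarrow> (nat \<Rightarrow> 'a) \<Rightarrow> nat \<Rightarrow> bool" where
  "diff_free_chain T b k \<longleftrightarrow> (\<forall>l<k. b l \<in> T \<and> (\<forall>j<l. b l - b j \<notin> T))"

lemma diff_free_chain_extend:
  assumes "diff_free_chain T b k" "y \<in> T" "\<forall>j<k. y - b j \<notin> T"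
  shows "diff_free_chain T (b(k := y)) (Suc k)"
  using assms unfolding diff_free_chain_def by (auto simp: less_Suc_eq)

lemma diff_free_chain_inv_image:
  assumes "inj f" "\<And>x y. f (x - y) = f x - f y" "diff_free_chain (f ` A) b k"
  shows "diff_free_chain A (inv f \<circ> b) k"
proof -
  have b: "b l = f (inv f (b l))" "inv f (b l) \<in> A" if "l < k" for l
    using assms(1,3) that unfolding diff_free_chain_def by (auto simp: f_inv_into_f)
  have "inv f (b l) - inv f (b j) \<notin> A" if "j < l" "l < k" for j l
  proof
    assume "inv f (b l) - inv f (b j) \<in> A"
    then have "b l - b j \<in> f ` A"
      using b that assms(2) by (metis image_eqI less_trans)
    then show False
      using assms(3) that unfolding diff_free_chain_def by blast
  qed
  then show ?thesis
    using b unfolding diff_free_chain_def by auto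
qed

text \<open>Maximising a functional that equals \<open>-1\<close> on \<open>B\<close> over \<open>T\<close> gives a point \<open>y\<close> with
  \<open>y - x \<notin> T\<close> for all \<open>x \<in> B\<close>, since the functional is larger at \<open>y - x\<close> than at \<open>y\<close>.\<close>
lemma exists_diff_free_extension:
  fixes B T :: "('a::linordered_field ^ 'n) set"
  assumes "finite T" "vec.independent B" "a \<in> T"
  shows "\<exists>y\<in>T. (\<forall>x\<in>B. y - x \<notin> T) \<and> (a \<notin> vec.span B \<longrightarrow> y \<notin> vec.span B)"
proof -
  obtain f where f: "Vector_Spaces.linear (*s) (*) f" "\<forall>x\<in>B. f x = -1"
    and f_sep: "a \<notin> vec.span B \<Longrightarrow> \<forall>y\<in>T \<inter> vec.span B. f y < f a"
  proof (cases "a \<in> vec.span B")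
    case True
    then show ?thesis
      using that linear_functional_extend[OF assms(2), of "\<lambda>_. -1"] by blast
  next
    case False
    then show ?thesis
      using that linear_functional_separating_span[OF assms(1,2) False] by blast
  qed
  have "Max (f ` T) \<in> f ` T"
    using assms(1,3) by (intro Max_in) auto
  then obtain y where y: "y \<in> T" "Max (f ` T) = f y"
    by blast
  have y_max: "f z \<le> f y" if "z \<in> T" for z
    using y(2)[symmetric] assms(1) that by simp
  have "y - x \<notin> T" if "x \<in> B" for x
  proof
    assume "y - x \<in> T"
    moreover have "f (y - x) = f y + 1"
      using linear_functional_diff[OF f(1)] f(2) that by simp
    ultimately show False
      using y_max by fastforce
  qed
  moreover have "y \<notin> vec.span B" if "a \<notin> vec.span B"
    using f_sep[OF that] y(1) y_max[OF assms(3)] by (meson IntI not_le)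
  ultimately show ?thesis
    using y(1) by blast
qed

lemma independent_diff_free_chain:
  fixes T :: "('a::linordered_field ^ 'n) set"
  assumes "finite T" "vec.span T = UNIV" "k \<le> CARD('n)"
  shows "\<exists>b. diff_free_chain T b k \<and> vec.independent (b ` {..<k}) \<and> card (b ` {..<k}) = k"
  using assms(3)
proof (induction k)
  case 0
  show ?case
    by (auto simp: diff_free_chain_def vec.independent_empty)
next
  case (Suc k)
  then obtain b where b: "diff_free_chain T b k" "vec.independent (b ` {..<k})"
      "card (b ` {..<k}) = k"
    by auto
  define B where "B = b ` {..<k}"
  have "\<not> T \<subseteq> vec.span B"
  proof
    assume "T \<subseteq> vec.span B"
    then have "vec.span B = UNIV"
      using assms(2) vec.span_minimal[OF _ vec.subspace_span] by blast
    then have "CARD('n) = k"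
      using vec.dim_span_eq_card_independent[OF b(2)] b(3) by (simp add: B_def card_cart_basis)
    then show False
      using Suc.prems by simp
  qed
  then obtain a where "a \<in> T" "a \<notin> vec.span B"
    by blast
  then obtain y where y: "y \<in> T" "\<forall>x\<in>B. y - x \<notin> T" "y \<notin> vec.span B"
    using exists_diff_free_extension[OF assms(1) b(2)[folded B_def]] by blast
  have "y \<notin> B"
    using y(3) vec.span_base by blast
  have img: "(b(k := y)) ` {..<Suc k} = insert y B"
    unfolding B_def lessThan_Suc by auto
  have "diff_free_chain T (b(k := y)) (Suc k)"
    using diff_free_chain_extend[OF b(1) y(1)] y(2) by (simp add: B_def)
  moreover have "vec.independent (insert y B)"
    using b(2) y(3) by (simp add: B_def vec.independent_insert)
  moreover have "card (insert y B) = Suc k"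
    using b(3) \<open>y \<notin> B\<close> by (simp add: B_def)
  ultimately show ?case
    unfolding img[symmetric] by blast
qed

lemma diff_free_chain_Suc_dim:
  fixes T :: "('a::linordered_field ^ 'n) set"
  assumes "finite T" "vec.span T = UNIV"
  shows "\<exists>b. diff_free_chain T b (Suc CARD('n))"
proof -
  obtain b where b: "diff_free_chain T b CARD('n)" "vec.independent (b ` {..<CARD('n)})"
    using independent_diff_free_chain[OF assms order_refl] by blast
  have "b 0 \<in> T"
    using b(1) unfolding diff_free_chain_def by simp
  then obtain y where "y \<in> T" "\<forall>x\<in>b ` {..<CARD('n)}. y - x \<notin> T"
    using exists_diff_free_extension[OF assms(1) b(2)] by blast
  then show ?thesis
    using diff_free_chain_extend[OF b(1)] by blast
qed

section \<open>Incompressibility\<close>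

text \<open>The translates \<open>A - a (k - 1), \<dots>, A - a 0\<close>, taken in this order, all contain \<open>0\<close>.\<close>
lemma diff_free_chain_le_incompressible:
  assumes "indiv_incompressible A C" "diff_free_chain A a k"
  shows "real k \<le> C"
proof -
  define u where "u i = - a (k - Suc i)" for i
  have "u i \<notin> (\<Union>j<i. translate A (u j))" if "i < k" for i
  proof
    assume "u i \<in> (\<Union>j<i. translate A (u j))"
    then obtain j x where "j < i" "x \<in> A" "u i = x + u j"
      unfolding translate_def by auto
    then have "a (k - Suc j) - a (k - Suc i) \<in> A"
      by (simp add: u_def algebra_simps)
    moreover have "k - Suc i < k - Suc j" "k - Suc j < k"
      using \<open>j < i\<close> that by auto
    ultimately show False
      using assms(2) unfolding diff_free_chain_def by blast
  qed
  moreover have "{i. i < k \<and> 0 \<in> translate A (u i)} = {..<k}"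
  proof -
    have "0 \<in> translate A (u i)" if "i < k" for i
    proof -
      have "a (k - Suc i) \<in> A"
        using assms(2) that unfolding diff_free_chain_def by simp
      then show ?thesis
        unfolding translate_def u_def by force
    qed
    then show ?thesis
      by auto
  qed
  ultimately show ?thesis
    using assms(1) unfolding indiv_incompressible_def by (metis card_lessThan)
qed

theorem proposition2p7:
  fixes A :: "(int ^ 'n) set" and C :: real
  assumes "finite A" and "0 \<in> A"
    and "group_rank (gen_subgroup A) = CARD('n)"
    and "indiv_incompressible A C"
  shows "C > real CARD('n)"
proof -
  have "vec.span (rat_vec ` A) = UNIV"
    using span_rat_vec_eq_UNIV_if_full_rank[OF assms(3)] .
  then obtain b where "diff_free_chain (rat_vec ` A) b (Suc CARD('n))"
    using diff_free_chain_Suc_dim finite_imageI[OF assms(1)] by blast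
  then have "diff_free_chain A (inv rat_vec \<circ> b) (Suc CARD('n))"
    using diff_free_chain_inv_image inj_rat_vec rat_vec_diff by blast
  then have "real (Suc CARD('n)) \<le> C"
    using diff_free_chain_le_incompressible assms(4) by blast
  then show ?thesis
    by simp
qed

end
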